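(* Let $k$ be a commutative Noetherian ring containing $\mathbb{Q}$. Then the category of FI-modules over $k$ is Noetherian: every sub-FI-module of a finitely generated FI-module over $k$ is finitely generated.
   Context: FI is the category whose objects are finite sets and whose morphisms are injections. An FI-module over a commutative ring $k$ is a functor $V$ from FI to the category of $k$-modules; write $V_S=V(S)$ and $V_n=V(\{1,\dots,n\})$. Sub-FI-modules are defined pointwise (a collection of submodules $W_S\subseteq V_S$ carried into each other by all maps $V(f)$). An FI-module $V$ is finitely generated if there is a finite set $\Sigma$ of elements of $\coprod_n V_n$ such that no proper sub-FI-module of $V$ contains $\Sigma$. *)

theory Defs
  imports "HOL-Algebra.Algebra" "HOL-Algebra.Algebraic_Closure_Type"
begin

text \<open>
  The category FI is modelled on the finite subsets of \<^typ>\<open>nat\<close>, a full subcategory of the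
  category of all finite sets and injections that contains every \<open>{1..n}\<close> and is equivalent to it.
  Morphisms are extensional functions, so that equal morphisms are equal as HOL functions.
\<close>

definition fi_hom :: "nat set \<Rightarrow> nat set \<Rightarrow> (nat \<Rightarrow> nat) set" where
  "fi_hom S T = {f \<in> S \<rightarrow>\<^sub>E T. inj_on f S}"

definition module_hom ::
    "('a, 'c) ring_scheme \<Rightarrow> ('a, 'm) module \<Rightarrow> ('a, 'n) module \<Rightarrow> ('m \<Rightarrow> 'n) set" where
  "module_hom k M N = {h \<in> carrier M \<rightarrow> carrier N.
     (\<forall>x\<in>carrier M. \<forall>y\<in>carrier M. h (x \<oplus>\<^bsub>M\<^esub> y) = h x \<oplus>\<^bsub>N\<^esub> h y) \<and>
     (\<forall>a\<in>carrier k. \<forall>x\<in>carrier M. h (a \<odot>\<^bsub>M\<^esub> x) = a \<odot>\<^bsub>N\<^esub> h x)}"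

text \<open>
  The modules \<open>V\<^sub>S\<close> of an FI-module share one element type but have independent carriers and
  operations; every set-indexed family of modules can be presented this way.  Source and target are
  arguments of \<open>fi_map\<close>, because a HOL function does not determine its codomain.
\<close>

record ('a, 'm) fi_mod =
  fi_obj :: "nat set \<Rightarrow> ('a, 'm) module"
  fi_map :: "nat set \<Rightarrow> nat set \<Rightarrow> (nat \<Rightarrow> nat) \<Rightarrow> 'm \<Rightarrow> 'm"

locale fi_module =
  fixes k :: "('a, 'c) ring_scheme" and V :: "('a, 'm) fi_mod"
  assumes obj_module: "finite S \<Longrightarrow> module k (fi_obj V S)"
    and map_hom: "\<lbrakk>finite S; finite T; f \<in> fi_hom S T\<rbrakk> \<Longrightarrow>
      fi_map V S T f \<in> module_hom k (fi_obj V S) (fi_obj V T)"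
    and map_id: "\<lbrakk>finite S; x \<in> carrier (fi_obj V S)\<rbrakk> \<Longrightarrow>
      fi_map V S S (restrict id S) x = x"
    and map_comp: "\<lbrakk>finite S; finite T; finite U; f \<in> fi_hom S T; g \<in> fi_hom T U;
        x \<in> carrier (fi_obj V S)\<rbrakk> \<Longrightarrow>
      fi_map V S U (compose S g f) x = fi_map V T U g (fi_map V S T f x)"

definition sub_fi_module ::
    "('a, 'c) ring_scheme \<Rightarrow> ('a, 'm) fi_mod \<Rightarrow> (nat set \<Rightarrow> 'm set) \<Rightarrow> bool" where
  "sub_fi_module k V W \<longleftrightarrow>
     (\<forall>S. finite S \<longrightarrow> submodule (W S) k (fi_obj V S)) \<and>
     (\<forall>S T f. finite S \<longrightarrow> finite T \<longrightarrow> f \<in> fi_hom S T \<longrightarrow> fi_map V S T f ` W S \<subseteq> W T)"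

text \<open>A sub-FI-module regarded as an FI-module in its own right.\<close>

definition fi_restrict :: "('a, 'm) fi_mod \<Rightarrow> (nat set \<Rightarrow> 'm set) \<Rightarrow> ('a, 'm) fi_mod" where
  "fi_restrict V W = V\<lparr>fi_obj := \<lambda>S. (fi_obj V S)\<lparr>carrier := W S\<rparr>\<rparr>"

definition fi_finitely_generated :: "('a, 'c) ring_scheme \<Rightarrow> ('a, 'm) fi_mod \<Rightarrow> bool" where
  "fi_finitely_generated k V \<longleftrightarrow>
     (\<exists>\<Sigma> \<subseteq> (SIGMA n:UNIV. carrier (fi_obj V {1..n})). finite \<Sigma> \<and>
       \<not> (\<exists>W. sub_fi_module k V W \<and> (\<exists>S. finite S \<and> W S \<noteq> carrier (fi_obj V S)) \<and>
              (\<forall>(n, x)\<in>\<Sigma>. x \<in> W {1..n})))"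

definition contains_rat :: "('a, 'c) ring_scheme \<Rightarrow> bool" where
  "contains_rat k \<longleftrightarrow>
     (\<exists>h \<in> ring_hom (ring_of_type_algebra :: rat ring) k. inj h)"

lemma fi_module_fi_restrict:
  assumes "fi_module k V" "sub_fi_module k V W"
  shows "fi_module k (fi_restrict V W)"
proof -
  interpret fi_module k V by fact
  have sub: "submodule (W S) k (fi_obj V S)" if "finite S" for S
    using assms(2) that by (auto simp: sub_fi_module_def)
  have sub_carrier: "x \<in> carrier (fi_obj V S)" if "finite S" "x \<in> W S" for S x
    using subgroup.subset[OF submodule.axioms(1)[OF sub[OF that(1)]]] that(2) by auto
  show ?thesis
  proof (rule fi_module.intro, goal_cases)
    case (1 S)
    then show ?case
      using submodule.submodule_is_module[OF sub obj_module] by (simp add: fi_restrict_def)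
  next
    case (2 S T f)
    then have "fi_map V S T f ` W S \<subseteq> W T"
      using assms(2) by (simp add: sub_fi_module_def)
    with map_hom[OF 2] sub_carrier[OF 2(1)] show ?case
      by (auto simp: module_hom_def fi_restrict_def)
  next
    case (3 S x)
    then show ?case using map_id sub_carrier by (simp add: fi_restrict_def)
  next
    case (4 S T U f g x)
    then show ?case using map_comp sub_carrier by (simp add: fi_restrict_def)
  qed
qed

end

theory Submission
  imports Defs "HOL-Library.List_Lexorder" "HOL-Library.Ramsey"
begin

text \<open>
  The proof is a Groebner basis argument.  Fix a finite list of generators \<open>x\<^sub>i \<in> V\<^bsub>{1..d\<^sub>i}\<^esub>\<close>.  Every
  \<open>V\<^sub>S\<close> is spanned by the values \<open>V(f)(x\<^sub>i)\<close> of the monomials \<open>(i, f)\<close>, \<open>f\<close> an injection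
  \<open>{1..d\<^sub>i} \<rightarrow> S\<close> (\<open>span_monomials\<close>).  Monomials are ordered lexicographically, first by \<open>i\<close> and
  then by the values of \<open>f\<close>; composition with a strictly increasing map \<open>h\<close> preserves this order.
  General injections do not preserve it, so the argument only moves along strictly increasing maps.

  For a sub-FI-module \<open>W\<close> and a monomial \<open>m\<close> over \<open>S\<close>, let \<open>lead W S m\<close> be the ideal of all leading
  coefficients \<open>a\<close> of elements \<open>a m + (lower monomials)\<close> of \<open>W\<^sub>S\<close>.  Three facts about these ideals
  give the theorem.

  \<^item> They grow along strictly increasing maps: \<open>lead W S m \<subseteq> lead W T (h \<circ> m)\<close> (\<open>lead_push\<close>).

  \<^item> They determine \<open>W\<close>: if \<open>U \<subseteq> W\<close> has the same leading coefficients then \<open>U = W\<close>, by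
    cancelling leading terms one after the other (\<open>subset_if_lead_subset\<close>).

  \<^item> Only finitely many of them matter: there is a finite set \<open>B\<close> of monomials such that each
    monomial \<open>m\<close> is \<open>h \<circ> b\<close> for a strictly increasing \<open>h\<close> and some \<open>b \<in> B\<close> with the same ideal
    (\<open>finite_lead_cover\<close>).  To see this for a fixed \<open>i\<close>, add \<open>0\<close> and \<open>n + 1\<close> to the values of
    \<open>f\<close>.  A strictly increasing \<open>h\<close> with \<open>h \<circ> f' = f\<close> exists as soon as no difference of two
    values, truncated at \<open>0\<close>, is smaller for \<open>f\<close> than for \<open>f'\<close> (\<open>strict_mono_extension\<close>).  So
    if \<open>f\<close> is not covered by \<open>f'\<close>, then one of finitely many differences drops or the ideal strictly
    grows; neither can go on forever, and Ramsey's theorem combines these finitely many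
    well-founded relations (\<open>finite_cover_of_finitely_many_wf\<close>).  For the differences alone this is
    Dickson's lemma.

  For each \<open>b \<in> B\<close> choose finitely many generators of the ideal \<open>lead W _ b\<close>, and for each of them
  an element of \<open>W\<close> with that leading coefficient.  A sub-FI-module \<open>U \<subseteq> W\<close> containing these elements
  has the same leading coefficients as \<open>W\<close> on \<open>B\<close>, hence on every monomial, hence equals \<open>W\<close>.
\<close>

section \<open>Finite covers from well-founded relations\<close>

text \<open>
  Colour a pair \<open>p < q\<close> by a relation that relates \<open>s q\<close> to \<open>s p\<close>.  Ramsey's theorem gives an infinite
  set of indices with only one colour, along which \<open>s\<close> descends forever in a single relation.
\<close>

lemma no_sequence_descending_in_finitely_many_wf:
  fixes s :: "nat \<Rightarrow> 'x"
  assumes fin: "finite \<R>" and wf: "\<And>r. r \<in> \<R> \<Longrightarrow> wf r"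
    and desc: "\<And>p q. p < q \<Longrightarrow> \<exists>r\<in>\<R>. (s q, s p) \<in> r"
  shows False
proof -
  obtain R :: "nat \<Rightarrow> _" and N where R: "\<R> = R ` {..<N}"
    using finite_imp_nat_seg_image_inj_on[OF fin] by (metis lessThan_def)
  define colour where
    "colour A = (SOME c. c < N \<and> (s (Max A), s (Min A)) \<in> R c)" for A :: "nat set"
  have colour: "colour {p, q} < N \<and> (s (max p q), s (min p q)) \<in> R (colour {p, q})"
    if "p \<noteq> q" for p q
  proof -
    have "\<exists>c. c < N \<and> (s (max p q), s (min p q)) \<in> R c"
      using desc[of "min p q" "max p q"] that R by (auto simp: min_def max_def)
    from someI_ex[OF this] show ?thesis by (simp add: colour_def)
  qed
  obtain Y t where Y: "infinite (Y :: nat set)" "t < N"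
    and mono: "\<forall>p\<in>Y. \<forall>q\<in>Y. p \<noteq> q \<longrightarrow> colour {p, q} = t"
    using Ramsey2[OF infinite_UNIV_nat, of colour N] colour by blast
  have "(s (enumerate Y (Suc j)), s (enumerate Y j)) \<in> R t" for j
  proof -
    have lt: "enumerate Y j < enumerate Y (Suc j)"
      using Y(1) by (simp add: enumerate_step)
    have "colour {enumerate Y j, enumerate Y (Suc j)} = t"
      using mono Y(1) lt by (metis enumerate_in_set nat_neq_iff)
    with colour[of "enumerate Y j" "enumerate Y (Suc j)"] lt show ?thesis
      by (simp add: max_def min_def)
  qed
  then have "\<not> wf (R t)"
    unfolding wf_iff_no_infinite_down_chain by (auto intro!: exI[of _ "\<lambda>j. s (enumerate Y j)"])
  with wf R Y(2) show False by blast
qed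

text \<open>
  If no finite set of elements were enough, one could keep choosing elements not covered by the
  earlier ones and obtain a sequence that the preceding lemma excludes.
\<close>

lemma finite_cover_of_finitely_many_wf:
  assumes fin: "finite \<R>" and wf: "\<And>r. r \<in> \<R> \<Longrightarrow> wf r"
  shows "\<exists>B\<subseteq>D. finite B \<and> (\<forall>x\<in>D. \<exists>b\<in>B. \<forall>r\<in>\<R>. (x, b) \<notin> r)"
proof (rule ccontr)
  assume neg: "\<not> ?thesis"
  have "\<exists>s :: nat \<Rightarrow> _. \<forall>q. s q \<in> D \<and> (\<forall>p<q. \<exists>r\<in>\<R>. (s q, s p) \<in> r)"
  proof (rule dependent_wellorder_choice)
    fix q :: nat and s :: "nat \<Rightarrow> 'a"
    assume "\<And>p. p < q \<Longrightarrow> s p \<in> D \<and> (\<forall>p'<p. \<exists>r\<in>\<R>. (s p, s p') \<in> r)"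
    then have "s ` {..<q} \<subseteq> D" by auto
    with neg obtain x where "x \<in> D" "\<forall>b\<in>s ` {..<q}. \<exists>r\<in>\<R>. (x, b) \<in> r"
      by (metis finite_imageI finite_lessThan)
    then show "\<exists>x. x \<in> D \<and> (\<forall>p<q. \<exists>r\<in>\<R>. (x, s p) \<in> r)" by auto
  qed auto
  then obtain s :: "nat \<Rightarrow> 'a" where s: "\<forall>q. s q \<in> D \<and> (\<forall>p<q. \<exists>r\<in>\<R>. (s q, s p) \<in> r)"
    by (rule exE)
  show False
    by (rule no_sequence_descending_in_finitely_many_wf[OF fin wf, where s = s]) (use s in simp_all)
qed

text \<open>
  The ascending chain condition, phrased so that passing to a larger ideal is a descent.
\<close>

lemma (in noetherian_ring) wf_strict_superideal:
  "wf {(I', I). ideal I R \<and> ideal I' R \<and> I \<subset> I'}"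
  unfolding wf_iff_no_infinite_down_chain
proof
  assume "\<exists>I. \<forall>i. (I (Suc i), I i) \<in> {(I', I). ideal I R \<and> ideal I' R \<and> I \<subset> I'}"
  then obtain I :: "nat \<Rightarrow> _"
    where chain: "\<forall>i. (I (Suc i), I i) \<in> {(I', I). ideal I R \<and> ideal I' R \<and> I \<subset> I'}"
    by (rule exE)
  have I: "ideal (I i) R" "I i \<subset> I (Suc i)" for i
    using chain[rule_format, of i] by simp_all
  have mono: "I i \<subseteq> I j" if "i \<le> j" for i j
    using that
  proof (induction rule: dec_induct)
    case (step n)
    then show ?case using I(2)[of n] by order
  qed simp
  have "subset.chain {I. ideal I R} (range I)"
    unfolding subset_chain_def
  proof (intro conjI ballI)
    fix J J' assume "J \<in> range I" "J' \<in> range I"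
    then obtain i j where "J = I i" "J' = I j" by auto
    then show "J \<subseteq> J' \<or> J' \<subseteq> J"
      using mono[of i j] mono[of j i] nat_le_linear[of i j] by auto
  qed (use I(1) in auto)
  with ideal_chain_is_trivial have "\<Union>(range I) \<in> range I" by (simp del: Union_iff)
  then obtain j where "\<Union>(range I) = I j" by (rule rangeE)
  then have "I (Suc j) \<subseteq> I j" by (metis Sup_upper rangeI)
  with I(2)[of j] show False by order
qed

section \<open>Extending a map to a strictly increasing one\<close>

text \<open>
  The map sends \<open>j\<close> to the largest value forced from the left: starting at some \<open>x a \<le> j\<close>, which must
  go to \<open>y a\<close>, each unit step raises the value by at least one.  The hypothesis on gaps says that
  these demands do not exceed \<open>y b\<close> at \<open>x b\<close>.  Subtraction is truncated, so gaps with
  \<open>x b \<le> x a\<close> impose nothing, and the others also force \<open>y a < y b\<close>.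
\<close>

lemma strict_mono_extension:
  fixes x y :: "'i \<Rightarrow> nat"
  assumes fin: "finite A" and base: "a\<^sub>0 \<in> A" "x a\<^sub>0 = 0" and inj: "inj_on x A"
    and gaps: "\<And>a b. \<lbrakk>a \<in> A; b \<in> A\<rbrakk> \<Longrightarrow> x b - x a \<le> y b - y a"
  obtains h where "strict_mono h" "\<And>a. a \<in> A \<Longrightarrow> h (x a) = y a"
proof
  define G where "G j = (\<lambda>a. y a + (j - x a)) ` {a \<in> A. x a \<le> j}" for j
  define h where "h j = Max (G j)" for j
  have G: "finite (G j)" "G j \<noteq> {}" for j
    using fin base by (auto simp: G_def)
  show "strict_mono h"
  proof (rule strict_mono_Suc_iff[THEN iffD2], rule allI)
    fix j
    have "h j \<in> G j" unfolding h_def using G by (rule Max_in)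
    then obtain a where a: "a \<in> A" "x a \<le> j" "h j = y a + (j - x a)" by (auto simp: G_def)
    (* The candidate that was largest at j grows by one, so the maximum grows. *)
    then have "Suc (h j) \<in> G (Suc j)" 
      unfolding G_def by (intro image_eqI[of _ _ a]) (simp_all add: Suc_diff_le)
    then show "h j < h (Suc j)"
      unfolding h_def[of "Suc j"] using Max_ge[OF G(1)] by (simp add: less_eq_Suc_le)
  qed
  show "h (x b) = y b" if b: "b \<in> A" for b
    unfolding h_def
  proof (rule Max_eqI[OF G(1)])
    show "y b \<in> G (x b)" unfolding G_def using b by (intro image_eqI[of _ _ b]) simp_all
    fix z assume "z \<in> G (x b)"
    then obtain a where a: "a \<in> A" "x a \<le> x b" "z = y a + (x b - x a)" by (auto simp: G_def)
    show "z \<le> y b"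
    proof (cases "a = b")
      case False
      then have "x a < x b" using inj a b by (auto simp: inj_on_def le_less)
      then show ?thesis using a(3) gaps[OF a(1) b] by linarith
    qed (use a in simp)
  qed
qed

section \<open>Spans in modules\<close>

text \<open>
  Building linear combinations one term at a time turns closure under homomorphisms and the
  splitting off of a single generator into plain inductions.
\<close>

inductive_set module_span ::
    "('a, 'c) ring_scheme \<Rightarrow> ('a, 'm, 'd) module_scheme \<Rightarrow> 'm set \<Rightarrow> 'm set"
  for k :: "('a, 'c) ring_scheme" and M :: "('a, 'm, 'd) module_scheme" and A :: "'m set" where
  zero: "\<zero>\<^bsub>M\<^esub> \<in> module_span k M A"
| step: "\<lbrakk>a \<in> carrier k; x \<in> A; y \<in> module_span k M A\<rbrakk> \<Longrightarrow>
    a \<odot>\<^bsub>M\<^esub> x \<oplus>\<^bsub>M\<^esub> y \<in> module_span k M A"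

lemma module_span_mono: "A \<subseteq> B \<Longrightarrow> module_span k M A \<subseteq> module_span k M B"
proof
  fix x assume "A \<subseteq> B" and "x \<in> module_span k M A"
  from this(2,1) show "x \<in> module_span k M B"
    by (induction) (auto intro: module_span.intros)
qed

lemma module_span_in_submodule:
  assumes "module k M" "submodule H k M" "A \<subseteq> H"
  shows "module_span k M A \<subseteq> H"
proof
  interpret module k M by fact
  note H = submoduleE[OF assms(2)]
  have zero: "\<zero>\<^bsub>M\<^esub> \<in> H" using subgroup.one_closed[OF submodule.axioms(1)[OF assms(2)]] by simp
  fix x assume "x \<in> module_span k M A"
  then show "x \<in> H"
    by induction (use zero assms(3) in \<open>auto intro: H(4,5)\<close>)
qed

context module
begin

lemma module_span_closed: "A \<subseteq> carrier M \<Longrightarrow> module_span R M A \<subseteq> carrier M"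
  by (rule module_span_in_submodule[OF module_axioms carrier_is_submodule])

lemma module_span_superset:
  assumes "A \<subseteq> carrier M"
  shows "A \<subseteq> module_span R M A"
proof
  fix x assume "x \<in> A"
  with module_span.step[OF R.one_closed this module_span.zero[where M = M]] assms
  show "x \<in> module_span R M A" by auto
qed

lemma module_span_add:
  assumes "A \<subseteq> carrier M" "x \<in> module_span R M A" "y \<in> module_span R M A"
  shows "x \<oplus>\<^bsub>M\<^esub> y \<in> module_span R M A"
  using assms(2)
proof induction
  case (step a u v)
  have "u \<in> carrier M" "v \<in> carrier M" "y \<in> carrier M"
    using step assms(1,3) module_span_closed[OF assms(1)] by auto
  then have "a \<odot>\<^bsub>M\<^esub> u \<oplus>\<^bsub>M\<^esub> v \<oplus>\<^bsub>M\<^esub> y = a \<odot>\<^bsub>M\<^esub> u \<oplus>\<^bsub>M\<^esub> (v \<oplus>\<^bsub>M\<^esub> y)"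
    using step(1) by (simp add: M.a_assoc)
  then show ?case using step by (auto intro: module_span.step)
next
  case zero
  have "y \<in> carrier M" using assms module_span_closed by blast
  then show ?case using assms(3) by simp
qed

lemma module_span_smult:
  assumes "A \<subseteq> carrier M" "c \<in> carrier R" "x \<in> module_span R M A"
  shows "c \<odot>\<^bsub>M\<^esub> x \<in> module_span R M A"
  using assms(3)
proof induction
  case (step a u v)
  have "u \<in> carrier M" "v \<in> carrier M"
    using step assms(1) module_span_closed[OF assms(1)] by auto
  then have "c \<odot>\<^bsub>M\<^esub> (a \<odot>\<^bsub>M\<^esub> u \<oplus>\<^bsub>M\<^esub> v) = (c \<otimes> a) \<odot>\<^bsub>M\<^esub> u \<oplus>\<^bsub>M\<^esub> c \<odot>\<^bsub>M\<^esub> v"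
    using step(1) assms(2) by (simp add: smult_r_distr smult_assoc1)
  then show ?case using step assms(2) by (auto intro: module_span.step)
qed (use assms in \<open>auto intro: module_span.zero\<close>)

lemma submoduleI_add_smult:
  assumes "H \<subseteq> carrier M" "\<zero>\<^bsub>M\<^esub> \<in> H"
    and "\<And>x y. \<lbrakk>x \<in> H; y \<in> H\<rbrakk> \<Longrightarrow> x \<oplus>\<^bsub>M\<^esub> y \<in> H"
    and "\<And>c x. \<lbrakk>c \<in> carrier R; x \<in> H\<rbrakk> \<Longrightarrow> c \<odot>\<^bsub>M\<^esub> x \<in> H"
  shows "submodule H R M"
proof (rule submoduleI)
  fix x assume x: "x \<in> H"
  then have "\<ominus>\<^bsub>M\<^esub> x = (\<ominus> \<one>) \<odot>\<^bsub>M\<^esub> x"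
    using assms(1) by (auto simp: smult_l_minus)
  with assms(4)[of "\<ominus> \<one>" x] x show "\<ominus>\<^bsub>M\<^esub> x \<in> H" by simp
qed (use assms in auto)

lemma submodule_module_span: "A \<subseteq> carrier M \<Longrightarrow> submodule (module_span R M A) R M"
  by (intro submoduleI_add_smult module_span_closed module_span.zero module_span_add module_span_smult)

text \<open>
  Splitting off one generator \<open>e\<close> produces the leading term \<open>a \<odot> e\<close> and the lower rest \<open>y\<close>.
\<close>

lemma module_span_insertE:
  assumes "insert e A \<subseteq> carrier M" "x \<in> module_span R M (insert e A)"
  obtains a y where "a \<in> carrier R" "y \<in> module_span R M A" "x = a \<odot>\<^bsub>M\<^esub> e \<oplus>\<^bsub>M\<^esub> y"
proof -
  have "\<exists>a\<in>carrier R. \<exists>y\<in>module_span R M A. x = a \<odot>\<^bsub>M\<^esub> e \<oplus>\<^bsub>M\<^esub> y"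
    using assms(2)
  proof induction
    case zero
    show ?case
      by (rule bexI[of _ \<zero>], rule bexI[of _ "\<zero>\<^bsub>M\<^esub>"]) (use assms(1) in \<open>auto intro: module_span.zero\<close>)
  next
    case (step b u v)
    then obtain a y where ay: "a \<in> carrier R" "y \<in> module_span R M A" "v = a \<odot>\<^bsub>M\<^esub> e \<oplus>\<^bsub>M\<^esub> y"
      by blast
    have A: "A \<subseteq> carrier M" using assms(1) by auto
    have carr: "y \<in> carrier M" "e \<in> carrier M" "u \<in> carrier M"
      using ay(2) module_span_closed[OF A] assms(1) step(2) by auto
    show ?case
    proof (cases "u = e")
      case True
      then have "b \<odot>\<^bsub>M\<^esub> u \<oplus>\<^bsub>M\<^esub> v = (b \<oplus> a) \<odot>\<^bsub>M\<^esub> e \<oplus>\<^bsub>M\<^esub> y"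
        using carr ay step(1) by (simp add: smult_l_distr M.a_assoc)
      then show ?thesis using ay step(1) by blast
    next
      case False
      have "b \<odot>\<^bsub>M\<^esub> u \<oplus>\<^bsub>M\<^esub> v = a \<odot>\<^bsub>M\<^esub> e \<oplus>\<^bsub>M\<^esub> (b \<odot>\<^bsub>M\<^esub> u \<oplus>\<^bsub>M\<^esub> y)"
        using carr ay step(1) by (simp add: M.a_lcomm)
      moreover have "b \<odot>\<^bsub>M\<^esub> u \<oplus>\<^bsub>M\<^esub> y \<in> module_span R M A"
        using False step(1,2) ay by (auto intro: module_span.step)
      ultimately show ?thesis using ay(1) by blast
    qed
  qed
  then show ?thesis using that by blast
qed

end

lemma module_hom_zero:
  assumes "module k M" "module k N" "h \<in> module_hom k M N"
  shows "h \<zero>\<^bsub>M\<^esub> = \<zero>\<^bsub>N\<^esub>"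
proof -
  interpret M: module k M by fact
  interpret N: module k N by fact
  have "h (\<zero>\<^bsub>k\<^esub> \<odot>\<^bsub>M\<^esub> \<zero>\<^bsub>M\<^esub>) = \<zero>\<^bsub>k\<^esub> \<odot>\<^bsub>N\<^esub> h \<zero>\<^bsub>M\<^esub>"
    using assms(3) M.R.zero_closed M.M.zero_closed unfolding module_hom_def by blast
  moreover have "h \<zero>\<^bsub>M\<^esub> \<in> carrier N"
    using assms(3) by (auto simp: module_hom_def)
  ultimately show ?thesis by simp
qed

lemma module_hom_span:
  assumes M: "module k M" "module k N" "h \<in> module_hom k M N" and A: "A \<subseteq> carrier M"
    and x: "x \<in> module_span k M A"
  shows "h x \<in> module_span k N (h ` A)"
  using x
proof induction
  case zero
  show ?case by (simp add: module_hom_zero[OF M] module_span.zero)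
next
  case (step a u v)
  interpret module k M by fact
  have "u \<in> carrier M" "v \<in> carrier M"
    using step A module_span_closed[OF A] by auto
  then have "h (a \<odot>\<^bsub>M\<^esub> u \<oplus>\<^bsub>M\<^esub> v) = a \<odot>\<^bsub>N\<^esub> h u \<oplus>\<^bsub>N\<^esub> h v"
    using assms(3) step(1) by (simp add: module_hom_def)
  then show ?case using step by (auto intro: module_span.step)
qed

section \<open>Monomials in a generated FI-module\<close>

lemma fi_hom_compose: "\<lbrakk>f \<in> fi_hom S T; g \<in> fi_hom T U\<rbrakk> \<Longrightarrow> compose S g f \<in> fi_hom S U"
  unfolding fi_hom_def by (auto simp: compose_def inj_on_def PiE_iff Pi_iff)

lemma fi_hom_range: "\<lbrakk>f \<in> fi_hom S T; j \<in> S\<rbrakk> \<Longrightarrow> f j \<in> T"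
  by (auto simp: fi_hom_def)

lemma fi_hom_restrict_id: "restrict id S \<in> fi_hom S S"
  by (auto simp: fi_hom_def inj_on_def)

lemma sub_fi_module_map:
  "\<lbrakk>sub_fi_module k V W; finite S; finite T; f \<in> fi_hom S T; x \<in> W S\<rbrakk> \<Longrightarrow> fi_map V S T f x \<in> W T"
  unfolding sub_fi_module_def by (simp add: image_subset_iff)

lemma map_less_map:
  fixes h :: "'x::linorder \<Rightarrow> 'y::linorder"
  assumes "strict_mono h"
  shows "xs < ys \<Longrightarrow> map h xs < map h ys"
proof (induction xs arbitrary: ys)
  case (Cons x xs)
  then show ?case using assms by (cases ys) (auto simp: strict_monoD)
next
  case Nil
  then show ?case by (cases ys) auto
qed

text \<open>
  A list of generators, rather than a finite set, provides the index that ranks monomials coming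
  from different generators.
\<close>

locale fi_generated = fi_module k V
  for k :: "('a, 'c) ring_scheme" and V :: "('a, 'm) fi_mod" +
  fixes gs :: "(nat \<times> 'm) list"
  assumes gs_carrier: "i < length gs \<Longrightarrow> snd (gs ! i) \<in> carrier (fi_obj V {1..fst (gs ! i)})"
    and gs_generate: "\<lbrakk>sub_fi_module k V U; \<forall>(n, x)\<in>set gs. x \<in> U {1..n}; finite S\<rbrakk> \<Longrightarrow>
      U S = carrier (fi_obj V S)"
begin

definition deg :: "nat \<Rightarrow> nat" where
  "deg i = fst (gs ! i)"

definition monomials :: "nat set \<Rightarrow> (nat \<times> (nat \<Rightarrow> nat)) set" where
  "monomials S = (SIGMA i:{..<length gs}. fi_hom {1..deg i} S)"

text \<open>
  A monomial \<open>(i, f)\<close> is a formal symbol; distinct monomials may have equal or linearly dependent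
  values in \<open>V\<close>.
\<close>

definition val :: "nat set \<Rightarrow> nat \<times> (nat \<Rightarrow> nat) \<Rightarrow> 'm" where
  "val S m = fi_map V {1..deg (fst m)} S (snd m) (snd (gs ! fst m))"

definition push :: "(nat \<Rightarrow> nat) \<Rightarrow> nat \<times> (nat \<Rightarrow> nat) \<Rightarrow> nat \<times> (nat \<Rightarrow> nat)" where
  "push h m = (fst m, compose {1..deg (fst m)} h (snd m))"

text \<open>
  The linear order on monomials is the lexicographic order of these lists.
\<close>

definition key :: "nat \<times> (nat \<Rightarrow> nat) \<Rightarrow> nat list" where
  "key m = fst m # map (snd m) [1..<Suc (deg (fst m))]"

lemma finite_monomials: "finite S \<Longrightarrow> finite (monomials S)"
  unfolding monomials_def fi_hom_def
  by (intro finite_SigmaI finite_lessThan finite_Collect_conjI disjI1)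
    (simp_all add: finite_PiE)

lemma push_in_monomials: "\<lbrakk>m \<in> monomials S; h \<in> fi_hom S T\<rbrakk> \<Longrightarrow> push h m \<in> monomials T"
  by (auto simp: monomials_def push_def intro: fi_hom_compose)

lemma map_carrier:
  "\<lbrakk>finite S; finite T; f \<in> fi_hom S T; x \<in> carrier (fi_obj V S)\<rbrakk> \<Longrightarrow>
    fi_map V S T f x \<in> carrier (fi_obj V T)"
  using map_hom[of S T f] by (auto simp: module_hom_def)

lemma gs_carrier': "i < length gs \<Longrightarrow> snd (gs ! i) \<in> carrier (fi_obj V {1..deg i})"
  using gs_carrier by (simp add: deg_def)

lemma val_carrier: "\<lbrakk>finite S; m \<in> monomials S\<rbrakk> \<Longrightarrow> val S m \<in> carrier (fi_obj V S)"
  unfolding val_def by (rule map_carrier) (auto simp: monomials_def gs_carrier' simp del: One_nat_def)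

lemma val_image_carrier: "finite S \<Longrightarrow> A \<subseteq> monomials S \<Longrightarrow> val S ` A \<subseteq> carrier (fi_obj V S)"
  using val_carrier by blast

lemma map_val:
  assumes "finite S" "finite T" "h \<in> fi_hom S T" "m \<in> monomials S"
  shows "fi_map V S T h (val S m) = val T (push h m)"
  using assms map_comp[of "{1..deg (fst m)}" S T "snd m" h "snd (gs ! fst m)"] gs_carrier'
  by (auto simp: val_def push_def monomials_def)

text \<open>
  The spans of the monomials form a sub-FI-module, which contains the generators as the monomials
  with \<open>f\<close> the identity.
\<close>

lemma span_monomials:
  assumes "finite S"
  shows "module_span k (fi_obj V S) (val S ` monomials S) = carrier (fi_obj V S)"
proof -
  define U where "U S = module_span k (fi_obj V S) (val S ` monomials S)" for S
  have "sub_fi_module k V U"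
    unfolding sub_fi_module_def
  proof safe
    fix S :: "nat set" assume S: "finite S"
    show "submodule (U S) k (fi_obj V S)"
      unfolding U_def
      by (rule module.submodule_module_span[OF obj_module[OF S] val_image_carrier[OF S order_refl]])
  next
    fix S T f x assume S: "finite S" "finite T" "f \<in> fi_hom S T" and x: "x \<in> U S"
    have "fi_map V S T f x \<in> module_span k (fi_obj V T) (fi_map V S T f ` val S ` monomials S)"
      using module_hom_span[OF obj_module[OF S(1)] obj_module[OF S(2)] map_hom[OF S]
          val_image_carrier[OF S(1) order_refl]] x by (simp add: U_def)
    moreover have "fi_map V S T f ` val S ` monomials S \<subseteq> val T ` monomials T"
      using map_val[OF S] push_in_monomials[OF _ S(3)] by auto
    ultimately show "fi_map V S T f x \<in> U T"
      unfolding U_def using module_span_mono by blast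
  qed
  moreover have "\<forall>(n, x)\<in>set gs. x \<in> U {1..n}"
  proof safe
    fix n x assume "(n, x) \<in> set gs"
    then obtain i where i: "i < length gs" "gs ! i = (n, x)" by (auto simp: in_set_conv_nth)
    define m where "m = (i, restrict id {1..n})"
    have m: "m \<in> monomials {1..n}"
      using i fi_hom_restrict_id by (simp add: m_def monomials_def deg_def)
    have "val {1..n} m = x"
      using i map_id[of "{1..n}" x] gs_carrier[OF i(1)] by (simp add: m_def val_def deg_def)
    with m module.module_span_superset[OF obj_module val_image_carrier[OF _ order_refl], of "{1..n}"]
    show "x \<in> U {1..n}" unfolding U_def by auto
  qed
  ultimately show ?thesis using gs_generate assms unfolding U_def by blast
qed

lemma inj_on_key: "inj_on key (monomials S)"
proof (rule inj_onI)
  fix m m' assume m: "m \<in> monomials S" "m' \<in> monomials S" and eq: "key m = key m'"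
  obtain i f i' f' where ii: "m = (i, f)" "m' = (i', f')" by fastforce
  have [simp]: "i' = i" using eq ii by (simp add: key_def)
  have "f j = f' j" for j
  proof (cases "j \<in> {1..deg i}")
    case True
    then show ?thesis using eq ii by (auto simp: key_def map_eq_conv)
  next
    case False
    then show ?thesis using m ii by (auto simp: monomials_def fi_hom_def PiE_iff extensional_def)
  qed
  then show "m = m'" using ii by auto
qed

lemma key_push:
  assumes "m \<in> monomials S"
  shows "key (push (restrict h S) m) = fst m # map h (tl (key m))"
proof -
  have "snd m j \<in> S" if "j \<in> {1..deg (fst m)}" for j
    using assms that fi_hom_range[OF _ that] by (auto simp: monomials_def)
  then show ?thesis by (auto simp: key_def push_def compose_def)
qed

text \<open>
  Compatibility of the monomial order with strictly increasing maps; this is what a general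
  injection lacks.
\<close>

lemma key_push_less:
  assumes "strict_mono h" "m \<in> monomials S" "m' \<in> monomials S" "key m' < key m"
  shows "key (push (restrict h S) m') < key (push (restrict h S) m)"
  using assms(4) unfolding key_push[OF assms(2)] key_push[OF assms(3)]
  by (auto simp: key_def map_less_map[OF assms(1)] simp del: map_map upt_Suc)

section \<open>Leading coefficient ideals\<close>

definition lower :: "nat set \<Rightarrow> nat \<times> (nat \<Rightarrow> nat) \<Rightarrow> (nat \<times> (nat \<Rightarrow> nat)) set" where
  "lower S m = {m' \<in> monomials S. key m' < key m}"

text \<open>
  Since the monomials may be linearly dependent, an element of \<open>W S\<close> can have many
  leading coefficients at \<open>m\<close>; all of them are collected.
\<close>

definition lead :: "(nat set \<Rightarrow> 'm set) \<Rightarrow> nat set \<Rightarrow> nat \<times> (nat \<Rightarrow> nat) \<Rightarrow> 'a set" where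
  "lead W S m = {a \<in> carrier k. \<exists>y\<in>module_span k (fi_obj V S) (val S ` lower S m).
     a \<odot>\<^bsub>fi_obj V S\<^esub> val S m \<oplus>\<^bsub>fi_obj V S\<^esub> y \<in> W S}"

lemma lower_subset: "lower S m \<subseteq> monomials S"
  by (auto simp: lower_def)

lemma ideal_lead:
  assumes W: "sub_fi_module k V W" and S: "finite S" and m: "m \<in> monomials S"
  shows "ideal (lead W S m) k"
proof -
  interpret module k "fi_obj V S" by (rule obj_module[OF S])
  let ?M = "fi_obj V S"
  let ?L = "module_span k ?M (val S ` lower S m)"
  have WS: "submodule (W S) k ?M" using W S by (simp add: sub_fi_module_def)
  note W' = submoduleE[OF WS]
  have low: "val S ` lower S m \<subseteq> carrier ?M" by (rule val_image_carrier[OF S lower_subset])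
  have L: "y \<in> carrier ?M" if "y \<in> ?L" for y using module_span_closed[OF low] that by auto
  have e: "val S m \<in> carrier ?M" by (rule val_carrier[OF S m])
  have zero: "\<zero>\<^bsub>k\<^esub> \<in> lead W S m"
    using e subgroup.one_closed[OF submodule.axioms(1)[OF WS]] module_span.zero
    by (force simp: lead_def intro!: bexI[of _ "\<zero>\<^bsub>?M\<^esub>"])
  have smult: "c \<otimes>\<^bsub>k\<^esub> a \<in> lead W S m" if c: "c \<in> carrier k" and a: "a \<in> lead W S m" for a c
  proof -
    obtain y where y: "a \<in> carrier k" "y \<in> ?L" "a \<odot>\<^bsub>?M\<^esub> val S m \<oplus>\<^bsub>?M\<^esub> y \<in> W S"
      using a by (auto simp: lead_def)
    have "c \<odot>\<^bsub>?M\<^esub> (a \<odot>\<^bsub>?M\<^esub> val S m \<oplus>\<^bsub>?M\<^esub> y)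
        = (c \<otimes>\<^bsub>k\<^esub> a) \<odot>\<^bsub>?M\<^esub> val S m \<oplus>\<^bsub>?M\<^esub> c \<odot>\<^bsub>?M\<^esub> y"
      using y c e L by (simp add: smult_r_distr smult_assoc1)
    then have "(c \<otimes>\<^bsub>k\<^esub> a) \<odot>\<^bsub>?M\<^esub> val S m \<oplus>\<^bsub>?M\<^esub> c \<odot>\<^bsub>?M\<^esub> y \<in> W S"
      using W'(4)[OF c y(3)] by simp
    then show ?thesis using c y module_span_smult[OF low c y(2)] by (auto simp: lead_def)
  qed
  have add: "a \<oplus>\<^bsub>k\<^esub> b \<in> lead W S m" if a: "a \<in> lead W S m" and b: "b \<in> lead W S m" for a b
  proof -
    obtain y where y: "a \<in> carrier k" "y \<in> ?L" "a \<odot>\<^bsub>?M\<^esub> val S m \<oplus>\<^bsub>?M\<^esub> y \<in> W S"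
      using a by (auto simp: lead_def)
    obtain z where z: "b \<in> carrier k" "z \<in> ?L" "b \<odot>\<^bsub>?M\<^esub> val S m \<oplus>\<^bsub>?M\<^esub> z \<in> W S"
      using b by (auto simp: lead_def)
    have "(a \<odot>\<^bsub>?M\<^esub> val S m \<oplus>\<^bsub>?M\<^esub> y) \<oplus>\<^bsub>?M\<^esub> (b \<odot>\<^bsub>?M\<^esub> val S m \<oplus>\<^bsub>?M\<^esub> z)
        = (a \<oplus>\<^bsub>k\<^esub> b) \<odot>\<^bsub>?M\<^esub> val S m \<oplus>\<^bsub>?M\<^esub> (y \<oplus>\<^bsub>?M\<^esub> z)"
      using y z e L by (simp add: smult_l_distr M.a_ac)
    then have "(a \<oplus>\<^bsub>k\<^esub> b) \<odot>\<^bsub>?M\<^esub> val S m \<oplus>\<^bsub>?M\<^esub> (y \<oplus>\<^bsub>?M\<^esub> z) \<in> W S"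
      using W'(5)[OF y(3) z(3)] by simp
    then show ?thesis using y z module_span_add[OF low y(2) z(2)] by (auto simp: lead_def)
  qed
  have carr: "lead W S m \<subseteq> carrier k" by (auto simp: lead_def)
  have "subgroup (lead W S m) (add_monoid k)"
  proof (rule R.add.subgroupI)
    fix a assume a: "a \<in> lead W S m"
    have "\<ominus>\<^bsub>k\<^esub> a = (\<ominus>\<^bsub>k\<^esub> \<one>\<^bsub>k\<^esub>) \<otimes>\<^bsub>k\<^esub> a" using a carr by (auto simp: R.l_minus)
    then show "\<ominus>\<^bsub>k\<^esub> a \<in> lead W S m" using smult[OF _ a, of "\<ominus>\<^bsub>k\<^esub> \<one>\<^bsub>k\<^esub>"] by simp
  qed (use carr zero add in auto)
  then show ?thesis
  proof (intro idealI R.ring_axioms)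
    fix a c assume a: "a \<in> lead W S m" and c: "c \<in> carrier k"
    then show "c \<otimes>\<^bsub>k\<^esub> a \<in> lead W S m" by (rule smult[rotated])
    then show "a \<otimes>\<^bsub>k\<^esub> c \<in> lead W S m" using a c carr R.m_comm[of a c] by auto
  qed
qed

text \<open>
  Applying \<open>h\<close> to an element of \<open>W S\<close> with leading term \<open>a \<odot> m\<close> moves the leading term to \<open>h \<circ> m\<close> with
  the same coefficient, because \<open>h\<close> keeps lower monomials lower.
\<close>

lemma lead_push:
  assumes W: "sub_fi_module k V W" and S: "finite S" "finite T" and m: "m \<in> monomials S"
    and h: "strict_mono h" "restrict h S \<in> fi_hom S T"
  shows "lead W S m \<subseteq> lead W T (push (restrict h S) m)"
proof
  let ?g = "fi_map V S T (restrict h S)"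
  fix a assume "a \<in> lead W S m"
  then obtain y where y: "a \<in> carrier k" "y \<in> module_span k (fi_obj V S) (val S ` lower S m)"
    "a \<odot>\<^bsub>fi_obj V S\<^esub> val S m \<oplus>\<^bsub>fi_obj V S\<^esub> y \<in> W S"
    by (auto simp: lead_def)
  interpret module k "fi_obj V S" by (rule obj_module[OF S(1)])
  have low: "val S ` lower S m \<subseteq> carrier (fi_obj V S)"
    by (rule val_image_carrier[OF S(1) lower_subset])
  have ycarr: "y \<in> carrier (fi_obj V S)" using module_span_closed[OF low] y(2) by auto
  have hom: "?g \<in> module_hom k (fi_obj V S) (fi_obj V T)" by (rule map_hom[OF S h(2)])
  have "?g (a \<odot>\<^bsub>fi_obj V S\<^esub> val S m \<oplus>\<^bsub>fi_obj V S\<^esub> y)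
      = a \<odot>\<^bsub>fi_obj V T\<^esub> ?g (val S m) \<oplus>\<^bsub>fi_obj V T\<^esub> ?g y"
    using hom y(1) ycarr val_carrier[OF S(1) m] by (simp add: module_hom_def)
  moreover have "?g (a \<odot>\<^bsub>fi_obj V S\<^esub> val S m \<oplus>\<^bsub>fi_obj V S\<^esub> y) \<in> W T"
    by (rule sub_fi_module_map[OF W S h(2) y(3)])
  ultimately have "a \<odot>\<^bsub>fi_obj V T\<^esub> val T (push (restrict h S) m) \<oplus>\<^bsub>fi_obj V T\<^esub> ?g y \<in> W T"
    by (simp add: map_val[OF S h(2) m])
  moreover have "?g y \<in> module_span k (fi_obj V T) (val T ` lower T (push (restrict h S) m))"
  proof -
    have "?g ` val S ` lower S m \<subseteq> val T ` lower T (push (restrict h S) m)"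
    proof safe
      fix m' assume m': "m' \<in> lower S m"
      then have mS: "m' \<in> monomials S" and less: "key m' < key m" by (simp_all add: lower_def)
      have "push (restrict h S) m' \<in> lower T (push (restrict h S) m)"
        unfolding lower_def
        using push_in_monomials[OF mS h(2)] key_push_less[OF h(1) m mS less] by blast
      then show "?g (val S m') \<in> val T ` lower T (push (restrict h S) m)"
        unfolding map_val[OF S h(2) mS] by (rule imageI)
    qed
    from module_span_mono[OF this] show ?thesis
      using module_hom_span[OF obj_module[OF S(1)] obj_module[OF S(2)] hom low y(2)] by (rule subsetD)
  qed
  ultimately show "a \<in> lead W T (push (restrict h S) m)"
    using y(1) unfolding lead_def by blast
qed

text \<open>
  Given \<open>w \<in> W S\<close> with leading term \<open>a \<odot> m\<close>, the hypothesis provides \<open>u \<in> U S\<close> with the same leading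
  term.  Then \<open>w - u\<close> lies in \<open>W S\<close> and involves only lower monomials, so induction puts it into
  \<open>U S\<close>.  The induction runs over sets of monomials that are closed downwards in the order.
\<close>

lemma subset_if_lead_subset:
  assumes W: "sub_fi_module k V W" and U: "sub_fi_module k V U" and UW: "U S \<subseteq> W S"
    and S: "finite S"
    and lead: "\<And>m. m \<in> monomials S \<Longrightarrow> lead W S m \<subseteq> lead U S m"
  shows "W S \<subseteq> U S"
proof -
  interpret module k "fi_obj V S" by (rule obj_module[OF S])
  let ?M = "fi_obj V S"
  have WS: "submodule (W S) k ?M" and US: "submodule (U S) k ?M"
    using W U S by (simp_all add: sub_fi_module_def)
  have *: "W S \<inter> module_span k ?M (val S ` A) \<subseteq> U S"
    if "A \<subseteq> monomials S" "\<And>m. m \<in> A \<Longrightarrow> lower S m \<subseteq> A" for A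
    using finite_subset[OF that(1) finite_monomials[OF S]] that
  proof (induction rule: finite_psubset_induct)
    case (psubset A)
    show ?case
    proof (cases "A = {}")
      case True
      have "\<zero>\<^bsub>?M\<^esub> \<in> U S" using subgroup.one_closed[OF submodule.axioms(1)[OF US]] by simp
      then have "module_span k ?M (val S ` A) \<subseteq> U S"
        using True module_span_in_submodule[OF module_axioms US, of "{}"] by simp
      then show ?thesis by blast
    next
      case False
      have "finite (key ` A)" "key ` A \<noteq> {}" using psubset.hyps False by auto
      from Max_in[OF this] obtain m where m: "m \<in> A" "key m = Max (key ` A)" by auto
      have mS: "m \<in> monomials S" using m psubset.prems by auto
      have max: "m' = m \<or> key m' < key m" if "m' \<in> A" for m'
        using Max_ge[of "key ` A" "key m'"] psubset that m inj_onD[OF inj_on_key, of m' m S] mS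
        by (force simp: le_less)
      (* Being closed downwards, A consists of its largest element and everything below it. *)
      have A: "A = insert m (lower S m)"
      proof
        show "A \<subseteq> insert m (lower S m)"
          using max psubset.prems(1) unfolding lower_def by blast
        show "insert m (lower S m) \<subseteq> A" using psubset.prems(2)[OF m(1)] m(1) by simp
      qed
      have mlow: "m \<notin> lower S m" by (simp add: lower_def)
      have IH: "W S \<inter> module_span k ?M (val S ` lower S m) \<subseteq> U S"
        by (rule psubset.IH) (use A mlow in \<open>auto simp: lower_def\<close>)
      have low: "val S ` lower S m \<subseteq> carrier ?M" by (rule val_image_carrier[OF S lower_subset])
      have e: "val S m \<in> carrier ?M" by (rule val_carrier[OF S mS])
      show ?thesis
      proof safe
        fix w assume w: "w \<in> W S" "w \<in> module_span k ?M (val S ` A)"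
        then have "w \<in> module_span k ?M (insert (val S m) (val S ` lower S m))"
          by (simp add: A[symmetric] flip: image_insert)
        then obtain a y where ay: "a \<in> carrier k" "y \<in> module_span k ?M (val S ` lower S m)"
          "w = a \<odot>\<^bsub>?M\<^esub> val S m \<oplus>\<^bsub>?M\<^esub> y"
          using module_span_insertE low e by (metis insert_subset)
        with w(1) have "a \<in> lead W S m" by (auto simp: lead_def)
        then have "a \<in> lead U S m" using lead[OF mS] by blast
        then obtain z where z: "z \<in> module_span k ?M (val S ` lower S m)"
          "a \<odot>\<^bsub>?M\<^esub> val S m \<oplus>\<^bsub>?M\<^esub> z \<in> U S" by (auto simp: lead_def)
        let ?u = "a \<odot>\<^bsub>?M\<^esub> val S m \<oplus>\<^bsub>?M\<^esub> z"
        note span = submodule_module_span[OF low]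
        have carr: "y \<in> carrier ?M" "z \<in> carrier ?M" "a \<odot>\<^bsub>?M\<^esub> val S m \<in> carrier ?M"
          using ay z e module_span_closed[OF low] by auto
        let ?e = "a \<odot>\<^bsub>?M\<^esub> val S m"
        have "w \<oplus>\<^bsub>?M\<^esub> \<ominus>\<^bsub>?M\<^esub> ?u = y \<oplus>\<^bsub>?M\<^esub> ?e \<oplus>\<^bsub>?M\<^esub> (\<ominus>\<^bsub>?M\<^esub> ?e \<oplus>\<^bsub>?M\<^esub> \<ominus>\<^bsub>?M\<^esub> z)"
          using carr M.a_comm[of y ?e] by (simp add: ay(3) M.minus_add)
        also have "\<dots> = y \<oplus>\<^bsub>?M\<^esub> (?e \<oplus>\<^bsub>?M\<^esub> (\<ominus>\<^bsub>?M\<^esub> ?e \<oplus>\<^bsub>?M\<^esub> \<ominus>\<^bsub>?M\<^esub> z))"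
          using carr by (simp add: M.a_assoc)
        also have "\<dots> = y \<oplus>\<^bsub>?M\<^esub> \<ominus>\<^bsub>?M\<^esub> z"
          using carr by (simp add: M.r_neg2)
        finally have wu: "w \<oplus>\<^bsub>?M\<^esub> \<ominus>\<^bsub>?M\<^esub> ?u = y \<oplus>\<^bsub>?M\<^esub> \<ominus>\<^bsub>?M\<^esub> z" .
        have "w \<oplus>\<^bsub>?M\<^esub> \<ominus>\<^bsub>?M\<^esub> ?u \<in> W S"
          using w(1) z(2) UW submoduleE(3,5)[OF WS] by auto
        moreover have "w \<oplus>\<^bsub>?M\<^esub> \<ominus>\<^bsub>?M\<^esub> ?u \<in> module_span k ?M (val S ` lower S m)"
          unfolding wu using ay(2) z(1) submoduleE(3,5)[OF span] by auto
        ultimately have "w \<oplus>\<^bsub>?M\<^esub> \<ominus>\<^bsub>?M\<^esub> ?u \<in> U S" using IH by auto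
        then have "w \<oplus>\<^bsub>?M\<^esub> \<ominus>\<^bsub>?M\<^esub> ?u \<oplus>\<^bsub>?M\<^esub> ?u \<in> U S"
          using z(2) submoduleE(5)[OF US] by auto
        moreover have "w \<oplus>\<^bsub>?M\<^esub> \<ominus>\<^bsub>?M\<^esub> ?u \<oplus>\<^bsub>?M\<^esub> ?u = w"
          using carr ay(3) by (simp add: M.a_assoc M.l_neg)
        ultimately show "w \<in> U S" by simp
      qed
    qed
  qed
  have "W S \<inter> module_span k ?M (val S ` monomials S) \<subseteq> U S"
    by (rule *) (auto simp: lower_def)
  then show ?thesis
    using span_monomials[OF S] submoduleE(1)[OF WS] by auto
qed

section \<open>Finitely many leading coefficient ideals suffice\<close>

text \<open>
  Monomials \<open>(i, f)\<close> over \<open>{1..n}\<close> for a fixed generator are compared through the truncated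
  differences of the values of \<open>f\<close>, to which \<open>0\<close> and \<open>n + 1\<close> are added as the values at \<open>0\<close> and \<open>d + 1\<close>.  These two
  sentinels make the strictly increasing map obtained from the differences send \<open>{1..n'}\<close> into
  \<open>{1..n}\<close>.  If no difference drops and the ideal does not strictly grow, then the ideal is
  constant, since it can only grow along the map.
\<close>

lemma finite_lead_cover_at_generator:
  assumes noeth: "noetherian_ring k" and W: "sub_fi_module k V W" and i: "i < length gs"
  defines "D \<equiv> (SIGMA n:UNIV. fi_hom {1..deg i} {1..n})"
  shows "\<exists>B\<subseteq>D. finite B \<and> (\<forall>(n, f)\<in>D. \<exists>(n', f')\<in>B. \<exists>h. strict_mono h \<and>
      restrict h {1..n'} \<in> fi_hom {1..n'} {1..n} \<and> push (restrict h {1..n'}) (i, f') = (i, f) \<and>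
      lead W {1..n'} (i, f') = lead W {1..n} (i, f))"
proof -
  define d where "d = deg i"
  define pos where "pos p a = (if a = 0 then 0 else if a = Suc d then Suc (fst p) else snd p a)"
    for p :: "nat \<times> (nat \<Rightarrow> nat)" and a
  define ld where "ld p = lead W {1..fst p} (i, snd p)" for p
  define gap where "gap = (\<lambda>(a, b). measure (\<lambda>p. pos p b - pos p a))"
  define bigger where
    "bigger = inv_image {(I', I). ideal I k \<and> ideal I' k \<and> I \<subset> I'} ld"
  define \<R> where "\<R> = insert bigger (gap ` ({..Suc d} \<times> {..Suc d}))"
  have "wf r" if "r \<in> \<R>" for r
    using that wf_inv_image[OF noetherian_ring.wf_strict_superideal[OF noeth]]
    unfolding \<R>_def bigger_def gap_def by (elim insertE imageE) (simp_all split: prod.splits)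
  moreover have "finite \<R>" by (simp add: \<R>_def)
  ultimately obtain B where B: "B \<subseteq> D" "finite B"
    and cover: "\<forall>p\<in>D. \<exists>q\<in>B. \<forall>r\<in>\<R>. (p, q) \<notin> r"
    using finite_cover_of_finitely_many_wf[of \<R> D] by metis
  have monoms: "(i, snd p) \<in> monomials {1..fst p}" if "p \<in> D" for p
    using that i by (auto simp: D_def monomials_def)
  have "\<exists>(n', f')\<in>B. \<exists>h. strict_mono h \<and> restrict h {1..n'} \<in> fi_hom {1..n'} {1..n} \<and>
      push (restrict h {1..n'}) (i, f') = (i, f) \<and>
      lead W {1..n'} (i, f') = lead W {1..n} (i, f)" if p: "(n, f) \<in> D" for n f
  proof -
    from bspec[OF cover p] obtain q0 where q0: "q0 \<in> B" "\<forall>r\<in>\<R>. ((n, f), q0) \<notin> r"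
      by (rule bexE)
    obtain n' f' where "q0 = (n', f')" by fastforce
    with q0 have q: "(n', f') \<in> B" and rel: "\<forall>r\<in>\<R>. ((n, f), (n', f')) \<notin> r"
      by simp_all
    have qD: "(n', f') \<in> D" using B(1) q by auto
    have f: "f \<in> fi_hom {1..d} {1..n}" and f': "f' \<in> fi_hom {1..d} {1..n'}"
      using p qD by (auto simp: D_def d_def)
    have f'_range: "0 < f' a \<and> f' a < Suc n'" if "a \<in> {1..d}" for a
      using fi_hom_range[OF f' that] by auto
    have f'_inj: "f' a \<noteq> f' b" if "a \<in> {1..d}" "b \<in> {1..d}" "a \<noteq> b" for a b
    proof -
      have "inj_on f' {1..d}" using f' by (simp add: fi_hom_def)
      with that show ?thesis by (metis inj_onD)
    qed
    have inj: "inj_on (pos (n', f')) {..Suc d}"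
    proof (rule linorder_inj_onI')
      fix a b assume ab: "a \<in> {..Suc d}" "b \<in> {..Suc d}" "a < b"
      have "b = Suc d \<or> b \<in> {1..d}" and "a = 0 \<or> a \<in> {1..d}" using ab by auto
      then show "pos (n', f') a \<noteq> pos (n', f') b"
        using f'_range[of a] f'_range[of b] f'_inj[of a b] ab(3) by (auto simp: pos_def)
    qed
    have gaps: "pos (n', f') b - pos (n', f') a \<le> pos (n, f) b - pos (n, f) a"
      if "a \<in> {..Suc d}" "b \<in> {..Suc d}" for a b
    proof -
      have "gap (a, b) \<in> \<R>" using that unfolding \<R>_def by blast
      with rel have "((n, f), (n', f')) \<notin> gap (a, b)" by (rule bspec)
      then show ?thesis by (simp add: gap_def)
    qed
    have "pos (n', f') 0 = 0" by (simp add: pos_def)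
    then obtain h where h: "strict_mono h" "\<And>a. a \<in> {..Suc d} \<Longrightarrow> h (pos (n', f') a) = pos (n, f) a"
      using strict_mono_extension[OF finite_atMost _ _ inj gaps, of 0] by auto
    have h_ends: "h 0 = 0" "h (Suc n') = Suc n"
      using h(2)[of 0] h(2)[of "Suc d"] by (simp_all add: pos_def)
    have "0 < h j \<and> h j < Suc n" if "j \<in> {1..n'}" for j
      using strict_monoD[OF h(1), of 0 j] strict_monoD[OF h(1), of j "Suc n'"] h_ends that by auto
    then have h_hom: "restrict h {1..n'} \<in> fi_hom {1..n'} {1..n}"
      using strict_mono_imp_inj_on[OF h(1)] by (auto simp: fi_hom_def inj_on_def less_Suc_eq_le Suc_le_eq)
    have "compose {1..d} (restrict h {1..n'}) f' = f"
    proof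
      fix a show "compose {1..d} (restrict h {1..n'}) f' a = f a"
      proof (cases "a \<in> {1..d}")
        case True
        then show ?thesis
          using h(2)[of a] f'_range[OF True] by (auto simp: compose_def pos_def)
      next
        case False
        then show ?thesis using f by (auto simp: compose_def fi_hom_def PiE_iff extensional_def)
      qed
    qed
    then have push: "push (restrict h {1..n'}) (i, f') = (i, f)" by (simp add: push_def d_def)
    have "lead W {1..n'} (i, f') \<subseteq> lead W {1..n} (i, f)"
      using lead_push[OF W _ _ monoms[OF qD], of "{1..n}" h] h(1) h_hom push by simp
    moreover have "\<not> ld (n', f') \<subset> ld (n, f)"
    proof -
      have "((n, f), (n', f')) \<notin> bigger" using rel by (simp add: \<R>_def)
      then show ?thesis
        using ideal_lead[OF W _ monoms[OF qD]] ideal_lead[OF W _ monoms[OF p]]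
        by (simp add: bigger_def ld_def)
    qed
    ultimately have "lead W {1..n'} (i, f') = lead W {1..n} (i, f)" by (auto simp: ld_def)
    then show ?thesis
      using h(1) h_hom push by (intro bexI[OF _ q] case_prodI exI[of _ h] conjI)
  qed
  then have "\<forall>(n, f)\<in>D. \<exists>(n', f')\<in>B. \<exists>h. strict_mono h \<and>
      restrict h {1..n'} \<in> fi_hom {1..n'} {1..n} \<and> push (restrict h {1..n'}) (i, f') = (i, f) \<and>
      lead W {1..n'} (i, f') = lead W {1..n} (i, f)"
    by (intro ballI) (simp only: split_paired_all case_prod_conv)
  with B show ?thesis by (intro exI[of _ B] conjI)
qed

lemma finite_lead_cover:
  assumes "noetherian_ring k" and "sub_fi_module k V W"
  shows "\<exists>B\<subseteq>(SIGMA n:UNIV. monomials {1..n}). finite B \<and> (\<forall>n. \<forall>m\<in>monomials {1..n}.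
      \<exists>(n', m')\<in>B. \<exists>h. strict_mono h \<and> restrict h {1..n'} \<in> fi_hom {1..n'} {1..n} \<and>
      push (restrict h {1..n'}) m' = m \<and> lead W {1..n'} m' = lead W {1..n} m)"
proof -
  define covers where "covers n m n' m' \<longleftrightarrow> (\<exists>h. strict_mono h \<and>
      restrict h {1..n'} \<in> fi_hom {1..n'} {1..n} \<and> push (restrict h {1..n'}) m' = m \<and>
      lead W {1..n'} m' = lead W {1..n} m)" for n m n' m'
  define D where "D i = (SIGMA n:UNIV. fi_hom {1..deg i} {1..n})" for i
  have "\<forall>i\<in>{..<length gs}. \<exists>B. B \<subseteq> D i \<and> finite B \<and>
      (\<forall>(n, f)\<in>D i. \<exists>(n', f')\<in>B. covers n (i, f) n' (i, f'))"
    unfolding covers_def D_def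
    by (intro ballI finite_lead_cover_at_generator[OF assms]) simp
  from bchoice[OF this] obtain B where
    B: "\<forall>i\<in>{..<length gs}. B i \<subseteq> D i \<and> finite (B i) \<and>
      (\<forall>(n, f)\<in>D i. \<exists>(n', f')\<in>B i. covers n (i, f) n' (i, f'))"
    by (rule exE)
  define C where "C = (\<Union>i<length gs. (\<lambda>(n, f). (n, (i, f))) ` B i)"
  have C1: "C \<subseteq> (SIGMA n:UNIV. monomials {1..n})"
  proof
    fix c assume "c \<in> C"
    then obtain i n f where c: "i < length gs" "(n, f) \<in> B i" "c = (n, (i, f))"
      by (auto simp: C_def)
    then have "(n, f) \<in> D i" using B by (meson lessThan_iff subsetD)
    then show "c \<in> (SIGMA n:UNIV. monomials {1..n})"
      using c(1,3) by (simp add: D_def monomials_def)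
  qed
  have C2: "finite C" using B unfolding C_def by (intro finite_UN_I finite_imageI) simp_all
  have C3: "\<exists>(n', m')\<in>C. covers n m n' m'" if mon: "m \<in> monomials {1..n}" for n m
  proof -
    obtain i f where m: "m = (i, f)" "i < length gs" "(n, f) \<in> D i"
      using mon by (auto simp: monomials_def D_def)
    then have "\<exists>(n', f')\<in>B i. covers n (i, f) n' (i, f')"
      using bspec[OF B, of i] by (auto dest: bspec)
    then obtain n' f' where "(n', f') \<in> B i" and cov: "covers n (i, f) n' (i, f')" by blast
    then have "(n', (i, f')) \<in> C" using m(2) by (auto simp: C_def)
    then show ?thesis using cov m(1) by (intro bexI[of _ "(n', (i, f'))"]) simp_all
  qed
  show ?thesis
    using C1 C2 C3 unfolding covers_def by (intro exI[of _ C] conjI allI ballI)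
qed

text \<open>
  A finite set is in bijection with some \<open>{1..n}\<close>, and such a bijection is an isomorphism of FI.
\<close>

lemma sub_fi_module_subsetI:
  assumes W: "sub_fi_module k V W" and U: "sub_fi_module k V U"
    and le: "\<And>n. W {1..n} \<subseteq> U {1..n}" and S: "finite S"
  shows "W S \<subseteq> U S"
proof
  fix w assume w: "w \<in> W S"
  obtain b where b: "bij_betw b {1..card S} S"
    using ex_bij_betw_nat_finite_1[OF S] by blast
  let ?f = "restrict b {1..card S}" and ?g = "restrict (the_inv_into {1..card S} b) S"
  have hom: "restrict c A \<in> fi_hom A A'" if "bij_betw c A A'" for c and A A' :: "nat set"
    unfolding fi_hom_def using that
    by (simp add: bij_betw_imp_funcset restrict_PiE_iff bij_betw_imp_inj_on inj_on_restrict_eq)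
  have f: "?f \<in> fi_hom {1..card S} S" by (rule hom[OF b])
  have binv: "bij_betw (the_inv_into {1..card S} b) S {1..card S}"
    by (rule bij_betw_the_inv_into[OF b])
  have g: "?g \<in> fi_hom S {1..card S}" by (rule hom[OF binv])
  have comp: "compose S ?f ?g = restrict id S"
  proof
    fix j
    show "compose S ?f ?g j = restrict id S j"
    proof (cases "j \<in> S")
      case True
      then have "the_inv_into {1..card S} b j \<in> {1..card S}" "b (the_inv_into {1..card S} b j) = j"
        using bij_betwE[OF binv] f_the_inv_into_f_bij_betw[OF b] by blast+
      with True show ?thesis by (simp add: compose_def)
    qed (simp add: compose_def)
  qed
  have "w \<in> carrier (fi_obj V S)"
  proof -
    have "submodule (W S) k (fi_obj V S)" using W S unfolding sub_fi_module_def by blast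
    from module.submoduleE(1)[OF obj_module[OF S] this] w show ?thesis by (rule subsetD)
  qed
  then have "w = fi_map V {1..card S} S ?f (fi_map V S {1..card S} ?g w)"
    using map_comp[OF S _ S g f] map_id[OF S] comp by simp
  moreover have "fi_map V S {1..card S} ?g w \<in> W {1..card S}"
    by (rule sub_fi_module_map[OF W S _ g w]) simp
  then have "fi_map V S {1..card S} ?g w \<in> U {1..card S}" using le by blast
  then have "fi_map V {1..card S} S ?f (fi_map V S {1..card S} ?g w) \<in> U S"
    by (rule sub_fi_module_map[OF U _ S f, rotated]) simp
  ultimately show "w \<in> U S" by simp
qed

text \<open>
  The generators are elements of \<open>W\<close> whose leading coefficients generate the ideals of the
  finitely many monomials in the cover.
\<close>

lemma finite_generators_of_sub_fi_module:
  assumes noeth: "noetherian_ring k" and W: "sub_fi_module k V W"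
  obtains \<Sigma> where "finite \<Sigma>" "\<Sigma> \<subseteq> (SIGMA n:UNIV. W {1..n})"
    "\<And>U S. \<lbrakk>sub_fi_module k V U; \<And>S. finite S \<Longrightarrow> U S \<subseteq> W S; \<forall>(n, x)\<in>\<Sigma>. x \<in> U {1..n}; finite S\<rbrakk>
      \<Longrightarrow> U S = W S"
proof -
  interpret k: noetherian_ring k by fact
  from finite_lead_cover[OF assms] obtain B where
    B: "B \<subseteq> (SIGMA n:UNIV. monomials {1..n})" "finite B"
    and cover: "\<forall>n. \<forall>m\<in>monomials {1..n}. \<exists>(n', m')\<in>B. \<exists>h. strict_mono h \<and>
      restrict h {1..n'} \<in> fi_hom {1..n'} {1..n} \<and> push (restrict h {1..n'}) m' = m \<and>
      lead W {1..n'} m' = lead W {1..n} m"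
    by (elim exE conjE)
  have mon: "m \<in> monomials {1..n}" if "(n, m) \<in> B" for n m
    using subsetD[OF B(1) that] by simp
  have idl: "ideal (lead U {1..n} m) k" if "sub_fi_module k V U" "(n, m) \<in> B" for U n m
    by (rule ideal_lead[OF that(1) _ mon[OF that(2)]]) simp
  have "\<forall>p\<in>B. \<exists>A. A \<subseteq> carrier k \<and> finite A \<and> lead W {1..fst p} (snd p) = Idl\<^bsub>k\<^esub> A"
  proof
    fix p assume "p \<in> B"
    then have "ideal (lead W {1..fst p} (snd p)) k" by (intro idl[OF W]) simp
    from k.finetely_gen[OF this]
    show "\<exists>A. A \<subseteq> carrier k \<and> finite A \<and> lead W {1..fst p} (snd p) = Idl\<^bsub>k\<^esub> A" .
  qed
  from bchoice[OF this] obtain A where A': "\<forall>p\<in>B. A p \<subseteq> carrier k \<and> finite (A p) \<and>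
      lead W {1..fst p} (snd p) = Idl\<^bsub>k\<^esub> (A p)"
    by (rule exE)
  have A: "A (n, m) \<subseteq> carrier k" "finite (A (n, m))" "lead W {1..n} m = Idl\<^bsub>k\<^esub> (A (n, m))"
    if "(n, m) \<in> B" for n m
    using bspec[OF A' that] by simp_all
  define wit where "wit n m a y \<longleftrightarrow>
    y \<in> module_span k (fi_obj V {1..n}) (val {1..n} ` lower {1..n} m) \<and>
    a \<odot>\<^bsub>fi_obj V {1..n}\<^esub> val {1..n} m \<oplus>\<^bsub>fi_obj V {1..n}\<^esub> y \<in> W {1..n}" for n m a y
  define low where "low n m a = (SOME y. wit n m a y)" for n m a
  have low: "wit n m a (low n m a)" if "(n, m) \<in> B" "a \<in> A (n, m)" for n m a
  proof -
    have "a \<in> lead W {1..n} m"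
      unfolding A(3)[OF that(1)] by (rule subsetD[OF k.genideal_self[OF A(1)[OF that(1)]] that(2)])
    then have "\<exists>y. wit n m a y" unfolding lead_def wit_def by blast
    then show ?thesis unfolding low_def by (rule someI_ex)
  qed
  define elt where "elt n m a =
    a \<odot>\<^bsub>fi_obj V {1..n}\<^esub> val {1..n} m \<oplus>\<^bsub>fi_obj V {1..n}\<^esub> low n m a" for n m a
  define \<Sigma> where "\<Sigma> = (\<Union>(n, m)\<in>B. (\<lambda>a. (n, elt n m a)) ` A (n, m))"
  show ?thesis
  proof (rule that)
    show "finite \<Sigma>"
      unfolding \<Sigma>_def using A(2) by (intro finite_UN_I[OF B(2)]) auto
    show "\<Sigma> \<subseteq> (SIGMA n:UNIV. W {1..n})"
    proof
      fix s assume "s \<in> \<Sigma>"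
      then obtain n m a where s: "(n, m) \<in> B" "a \<in> A (n, m)" "s = (n, elt n m a)"
        unfolding \<Sigma>_def by blast
      then show "s \<in> (SIGMA n:UNIV. W {1..n})"
        using low[OF s(1,2)] by (simp add: elt_def wit_def)
    qed
    fix U S
    assume U: "sub_fi_module k V U" and UW: "\<And>S. finite S \<Longrightarrow> U S \<subseteq> W S"
      and \<Sigma>U: "\<forall>(n, x)\<in>\<Sigma>. x \<in> U {1..n}" and S: "finite (S :: nat set)"
    (* U contains an element with leading coefficient a for each generator a of the ideal. *)
    have lead_B: "lead W {1..n} m \<subseteq> lead U {1..n} m" if B': "(n, m) \<in> B" for n m
    proof -
      have "A (n, m) \<subseteq> lead U {1..n} m"
      proof
        fix a assume a: "a \<in> A (n, m)"
        then have "(n, elt n m a) \<in> \<Sigma>" using B' unfolding \<Sigma>_def by blast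
        from bspec[OF \<Sigma>U this] have "elt n m a \<in> U {1..n}" by simp
        moreover have "a \<in> carrier k" using A(1)[OF B'] a by (rule subsetD)
        ultimately show "a \<in> lead U {1..n} m"
          using low[OF B' a] unfolding lead_def elt_def wit_def by blast
      qed
      then have "Idl\<^bsub>k\<^esub> (A (n, m)) \<subseteq> lead U {1..n} m"
        by (rule k.genideal_minimal[OF idl[OF U B']])
      then show ?thesis unfolding A(3)[OF B'] .
    qed
    have "W {1..n} \<subseteq> U {1..n}" for n
    proof (rule subset_if_lead_subset[OF W U UW])
      fix m assume m: "m \<in> monomials {1..n}"
      from bspec[OF spec[OF cover] m] obtain p where p: "p \<in> B"
        "case p of (n', m') \<Rightarrow> \<exists>h. strict_mono h \<and>
          restrict h {1..n'} \<in> fi_hom {1..n'} {1..n} \<and> push (restrict h {1..n'}) m' = m \<and>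
          lead W {1..n'} m' = lead W {1..n} m"
        by (rule bexE)
      obtain n' m' where p_eq: "p = (n', m')" by (cases p)
      with p obtain h where c: "(n', m') \<in> B" "strict_mono h"
        "restrict h {1..n'} \<in> fi_hom {1..n'} {1..n}" "push (restrict h {1..n'}) m' = m"
        "lead W {1..n'} m' = lead W {1..n} m" by auto
      have "lead U {1..n'} m' \<subseteq> lead U {1..n} m"
        using lead_push[OF U _ _ mon[OF c(1)] c(2,3)] c(4) by simp
      with lead_B[OF c(1)] c(5) show "lead W {1..n} m \<subseteq> lead U {1..n} m" by simp
    qed simp_all
    then have "W S \<subseteq> U S" by (rule sub_fi_module_subsetI[OF W U _ S])
    with UW[OF S] show "U S = W S" by auto
  qed
qed

end

section \<open>Noetherianity\<close>

lemma fi_generated_if_finitely_generated: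
  assumes "fi_module k V" and "fi_finitely_generated k V"
  obtains gs where "fi_generated k V gs"
proof -
  obtain \<Sigma> where \<Sigma>: "\<Sigma> \<subseteq> (SIGMA n:UNIV. carrier (fi_obj V {1..n}))" "finite \<Sigma>"
    and gen: "\<not> (\<exists>W. sub_fi_module k V W \<and> (\<exists>S. finite S \<and> W S \<noteq> carrier (fi_obj V S)) \<and>
              (\<forall>(n, x)\<in>\<Sigma>. x \<in> W {1..n}))"
    using assms(2) unfolding fi_finitely_generated_def by blast
  obtain gs where gs: "set gs = \<Sigma>" using finite_list[OF \<Sigma>(2)] by blast
  interpret fi_module k V by fact
  have "fi_generated k V gs"
  proof
    fix i assume "i < length gs"
    then have "gs ! i \<in> \<Sigma>" using gs nth_mem by blast
    then show "snd (gs ! i) \<in> carrier (fi_obj V {1..fst (gs ! i)})" using \<Sigma>(1) by auto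
  qed (use gen gs in blast)
  then show ?thesis by (rule that)
qed

text \<open>
  Sub-FI-modules of \<open>W\<close> are sub-FI-modules of \<open>V\<close>, so that leading coefficients can be taken in \<open>V\<close>.
\<close>

lemma sub_fi_module_of_restrict:
  assumes V: "fi_module k V" and W: "sub_fi_module k V W"
    and U: "sub_fi_module k (fi_restrict V W) U"
  shows "sub_fi_module k V U" and "finite S \<Longrightarrow> U S \<subseteq> W S"
proof -
  interpret V: fi_module k V by fact
  interpret R: fi_module k "fi_restrict V W" by (rule fi_module_fi_restrict[OF V W])
  have sub: "U S \<subseteq> W S" if "finite S" for S
    using U that module.submoduleE(1)[OF R.obj_module[OF that]]
    by (fastforce simp: sub_fi_module_def fi_restrict_def)
  show "finite S \<Longrightarrow> U S \<subseteq> W S" by (rule sub)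
  show "sub_fi_module k V U"
    unfolding sub_fi_module_def
  proof safe
    fix S :: "nat set" assume S: "finite S"
    have WS: "submodule (W S) k (fi_obj V S)" using W S by (simp add: sub_fi_module_def)
    have US: "submodule (U S) k (fi_obj V S\<lparr>carrier := W S\<rparr>)"
      using U S by (simp add: sub_fi_module_def fi_restrict_def)
    interpret module k "fi_obj V S" by (rule V.obj_module[OF S])
    show "submodule (U S) k (fi_obj V S)"
    proof (rule submoduleI_add_smult)
      show "U S \<subseteq> carrier (fi_obj V S)" using sub[OF S] submoduleE(1)[OF WS] by blast
      show "\<zero>\<^bsub>fi_obj V S\<^esub> \<in> U S"
        using subgroup.one_closed[OF submodule.axioms(1)[OF US]] by simp
      show "x \<oplus>\<^bsub>fi_obj V S\<^esub> y \<in> U S" if "x \<in> U S" "y \<in> U S" for x y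
        using subgroup.m_closed[OF submodule.axioms(1)[OF US] that] by simp
      show "c \<odot>\<^bsub>fi_obj V S\<^esub> x \<in> U S" if "c \<in> carrier k" "x \<in> U S" for c x
        using submodule.smult_closed[OF US that] by simp
    qed
  next
    fix S T f x assume "finite S" "finite T" "f \<in> fi_hom S T" "x \<in> U S"
    then show "fi_map V S T f x \<in> U T"
      using sub_fi_module_map[OF U, of S T f x] by (simp add: fi_restrict_def)
  qed
qed

theorem theorem1p3:
  fixes k :: "('a, 'c) ring_scheme"
    and V :: "('a, 'm) fi_mod"
    and W :: "nat set \<Rightarrow> 'm set"
  assumes "cring k" and "noetherian_ring k" and "contains_rat k"
    and "fi_module k V" and "fi_finitely_generated k V"
    and "sub_fi_module k V W"
  shows "fi_finitely_generated k (fi_restrict V W)"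
proof -
  obtain gs where gs: "fi_generated k V gs"
    using fi_generated_if_finitely_generated[OF assms(4,5)] .
  obtain \<Sigma> where \<Sigma>: "finite \<Sigma>" "\<Sigma> \<subseteq> (SIGMA n:UNIV. W {1..n})"
    and gen: "\<And>U S. \<lbrakk>sub_fi_module k V U; \<And>S. finite S \<Longrightarrow> U S \<subseteq> W S;
      \<forall>(n, x)\<in>\<Sigma>. x \<in> U {1..n}; finite S\<rbrakk> \<Longrightarrow> U S = W S"
    using fi_generated.finite_generators_of_sub_fi_module[OF gs assms(2,6)] by metis
  have "U S = carrier (fi_obj (fi_restrict V W) S)"
    if U: "sub_fi_module k (fi_restrict V W) U" "\<forall>(n, x)\<in>\<Sigma>. x \<in> U {1..n}" "finite S" for U S
    using gen[OF sub_fi_module_of_restrict[OF assms(4,6) U(1)] U(2,3)]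
    by (simp add: fi_restrict_def)
  moreover have "\<Sigma> \<subseteq> (SIGMA n:UNIV. carrier (fi_obj (fi_restrict V W) {1..n}))"
    using \<Sigma>(2) by (simp add: fi_restrict_def)
  ultimately show ?thesis
    unfolding fi_finitely_generated_def using \<Sigma>(1) by blast
qed

end
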